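(* For fixed integers $r,s\ge0$ with $r+s\ge1$, the property $\Pi_{r,s}$ of being $(r,s)$-colourable admits a size-oblivious one-sided error tester with query complexity $$\widetilde O\!\left(\frac{(r+s)^6}{\varepsilon^6}\right).$$
   Context: A graph is a finite simple labelled graph. A graph is $(r,s)$-colourable if its vertex set can be partitioned into $r$ independent sets and $s$ cliques; empty parts are allowed. Distance: for graphs $G,G'$ on the same $n$-element vertex set, $\mathrm{dist}(G,G')=|E(G)\triangle E(G')|/n^2$; $G$ is $\varepsilon$-far from a graph property $\Pi$ if the minimum of $\mathrm{dist}(G,G')$ over $G'\in\Pi$ with $V(G')=V(G)$ exceeds $\varepsilon$. A size-oblivious tester for $\Pi$ is a randomized oracle algorithm which, given $\varepsilon>0$ but not $|V(G)|$, has oracle access to the adjacency predicate of $G$ and to independent uniform samples from $V(G)$ (a request for a sample larger than the input being interpreted as a request to inspect the whole graph), accepts every $G\in\Pi$ with probability at least $2/3$, and rejects every $G$ that is $\varepsilon$-far from $\Pi$ with probability at least $2/3$. Its query complexity is the maximum number of adjacency queries and its sample complexity the maximum number of vertex labels inspected; both must be bounded in terms of $\varepsilon$ only. It has one-sided error if it accepts every graph in $\Pi$ with probability one. $\widetilde O(\cdot)$ hides polylogarithmic factors in the displayed quantities. *)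

theory Defs
  imports "HOL-Probability.Probability" "HOL-Library.Ramsey"
begin

section \<open>Labelled graphs and colourability\<close>

record graph =
  verts :: "nat set"
  edges :: "nat set set"

definition simple_graph :: "graph \<Rightarrow> bool" where
  "simple_graph G \<longleftrightarrow> finite (verts G) \<and> edges G \<subseteq> nsets (verts G) 2"

definition colourable :: "nat \<Rightarrow> nat \<Rightarrow> graph \<Rightarrow> bool" where
  "colourable r s G \<longleftrightarrow>
     (\<exists>P :: nat \<Rightarrow> nat set.
        disjoint_family_on P {..<r + s} \<and> (\<Union>i<r + s. P i) = verts G \<and>
        (\<forall>i<r. indep (P i) (edges G)) \<and> (\<forall>i\<in>{r..<r + s}. clique (P i) (edges G)))"

definition colourable_graphs :: "nat \<Rightarrow> nat \<Rightarrow> graph set" where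
  "colourable_graphs r s = {G. simple_graph G \<and> colourable r s G}"


section \<open>Distance to a property\<close>

definition graph_dist :: "graph \<Rightarrow> graph \<Rightarrow> real" where
  "graph_dist G G' = real (card (sym_diff (edges G) (edges G'))) / (real (card (verts G)))\<^sup>2"

text \<open>For a property consisting of simple graphs the infimum ranges over finitely many values,
  so it is a minimum; it is \<open>\<infinity>\<close> if no graph on the vertex set of \<open>G\<close> has the property.\<close>

definition far_from :: "real \<Rightarrow> graph set \<Rightarrow> graph \<Rightarrow> bool" where
  "far_from \<epsilon> \<P> G \<longleftrightarrow>
     ereal \<epsilon> < (INF G'\<in>{G' \<in> \<P>. verts G' = verts G}. ereal (graph_dist G G'))"


section \<open>Randomized oracle algorithms\<close>

text \<open>An algorithm is an adaptive interaction tree: it may toss a fair coin, query whether two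
  labels are adjacent, request a sample of a given size, or stop with a verdict (\<open>True\<close> for
  accepting). The tree does not refer to the input graph.\<close>

datatype algorithm =
    Verdict bool
  | Toss "bool \<Rightarrow> algorithm"
  | Query nat nat "bool \<Rightarrow> algorithm"
  | Sample nat "nat list \<Rightarrow> algorithm"

text \<open>A request for more vertices than there are is answered by a list of the whole vertex set.
  The algorithm recognises this case, as the list is then shorter than requested. Otherwise the
  answer consists of independent uniform vertices, drawn with replacement.\<close>

definition sample_oracle :: "graph \<Rightarrow> nat \<Rightarrow> nat list pmf" where
  "sample_oracle G m =
     (if m > card (verts G) then return_pmf (sorted_list_of_set (verts G))
      else replicate_pmf m (pmf_of_set (verts G)))"

text \<open>The components of the outcome of a run are the verdict, the number of adjacency queries made,
  and the number of vertex labels received. Adjacency queries are charged also after the whole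
  vertex set has been received.\<close>

primrec run :: "graph \<Rightarrow> algorithm \<Rightarrow> (bool \<times> nat \<times> nat) pmf" where
  "run G (Verdict b) = return_pmf (b, 0, 0)"
| "run G (Toss k) = bind_pmf (bernoulli_pmf (1/2)) (\<lambda>b. run G (k b))"
| "run G (Query u v k) =
     map_pmf (\<lambda>(b, q, l). (b, Suc q, l)) (run G (k ({u, v} \<in> edges G)))"
| "run G (Sample m k) =
     bind_pmf (sample_oracle G m)
       (\<lambda>xs. map_pmf (\<lambda>(b, q, l). (b, q, length xs + l)) (run G (k xs)))"

definition accept_prob :: "graph \<Rightarrow> algorithm \<Rightarrow> real" where
  "accept_prob G A = measure_pmf.prob (run G A) {(b, q, l). b}"

definition reject_prob :: "graph \<Rightarrow> algorithm \<Rightarrow> real" where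
  "reject_prob G A = measure_pmf.prob (run G A) {(b, q, l). \<not> b}"

definition query_complexity :: "algorithm \<Rightarrow> enat" where
  "query_complexity A =
     (SUP G\<in>{G. simple_graph G}. SUP (b, q, l)\<in>set_pmf (run G A). enat q)"

definition sample_complexity :: "algorithm \<Rightarrow> enat" where
  "sample_complexity A =
     (SUP G\<in>{G. simple_graph G}. SUP (b, q, l)\<in>set_pmf (run G A). enat l)"


section \<open>Size-oblivious testers\<close>

text \<open>The algorithm \<open>T \<epsilon>\<close> is chosen before the graph. As both complexities are suprema over all
  simple graphs, their finiteness says that they are bounded in terms of \<open>\<epsilon>\<close> only.\<close>

definition size_oblivious_tester :: "graph set \<Rightarrow> (real \<Rightarrow> algorithm) \<Rightarrow> bool" where
  "size_oblivious_tester \<P> T \<longleftrightarrow>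
     (\<forall>\<epsilon>>0.
        query_complexity (T \<epsilon>) < \<infinity> \<and> sample_complexity (T \<epsilon>) < \<infinity> \<and>
        (\<forall>G. simple_graph G \<longrightarrow>
           (G \<in> \<P> \<longrightarrow> accept_prob G (T \<epsilon>) \<ge> 2/3) \<and>
           (far_from \<epsilon> \<P> G \<longrightarrow> reject_prob G (T \<epsilon>) \<ge> 2/3)))"

definition one_sided :: "graph set \<Rightarrow> (real \<Rightarrow> algorithm) \<Rightarrow> bool" where
  "one_sided \<P> T \<longleftrightarrow> (\<forall>\<epsilon>>0. \<forall>G\<in>\<P>. accept_prob G (T \<epsilon>) = 1)"

end

theory Submission
  imports Defs
begin

text \<open>The tester draws a sample, queries all pairs inside it, and accepts iff the induced subgraph is
  colourable. Colourability is inherited by induced subgraphs, so a colourable graph is never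
  rejected. A request exceeding the graph returns all vertices, and the verdict is then exact.

  For soundness, colours below \<open>r\<close> (independent sets) and colours from \<open>r\<close> on (cliques) are put on the
  same footing: each colour has its own conflict relation, namely adjacency or non-adjacency of
  distinct vertices. An argument of Alon and Krivelevich for ordinary colourings then applies. Give
  every vertex a list of admissible colours. Colouring one vertex strikes its colour from the lists
  of all vertices in conflict with it. Call a vertex restricting if each of its admissible colours
  would strike at least \<open>\<delta> n\<close> entries, where \<open>n\<close> is the number of vertices; a vertex with an empty list
  is restricting for trivial reasons. If fewer than \<open>\<delta> n\<close> vertices were restricting, giving every other
  vertex a colour that strikes fewer than \<open>\<delta> n\<close> entries would produce a colouring with at most
  \<open>2 \<delta> n\<^sup>2\<close> violated pairs. So, with \<open>\<delta> = \<epsilon> / 2\<close>, a graph that is \<open>\<epsilon>\<close>-far has at least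
  \<open>\<delta> n\<close> restricting vertices for every system of lists
  (\<open>many_restricting_vertices_if_far\<close>).

  Now reveal the sample one vertex at a time. A restricting vertex has at most \<open>k = r + s\<close> colours to
  choose from, and each choice removes at least \<open>\<delta> n\<close> of the at most \<open>k n\<close> list entries. The quantity
  \<open>(2 k) powr (weight / (\<delta> n))\<close> therefore shrinks by a factor \<open>2 k\<close>, which pays for the union bound
  over the colours and leaves a factor \<open>1 / 2\<close>. As a restricting vertex is hit with probability at least
  \<open>\<delta>\<close>, the colourability probability decays like \<open>(1 - \<delta> / 2) ^ t\<close> in the sample size \<open>t\<close>
  (\<open>prob_list_colourable_le\<close>). A sample of order \<open>k ln (2 k) / \<epsilon>\<^sup>2\<close>, up to a
  term of order \<open>1 / \<epsilon>\<close>, is thus enough. Its square is of order \<open>(k / \<epsilon>) ^ 4\<close> up to logarithms, which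
  is below the claimed sixth power.\<close>

section \<open>List colourings\<close>

text \<open>The edge relation of the graph in which colour class \<open>i\<close> has to be independent: this is \<open>G\<close> for
  \<open>i < r\<close> and the complement of \<open>G\<close> for \<open>r \<le> i\<close>.\<close>

definition conflict :: "nat \<Rightarrow> graph \<Rightarrow> nat \<Rightarrow> nat \<Rightarrow> nat \<Rightarrow> bool" where
  "conflict r G i u v \<longleftrightarrow> u \<noteq> v \<and> ({u, v} \<in> edges G) \<noteq> (r \<le> i)"

text \<open>The lists \<open>L\<close> record what is left of the palette after a part of the graph has been coloured.\<close>

definition list_colourable :: "nat \<Rightarrow> graph \<Rightarrow> nat set \<Rightarrow> (nat \<Rightarrow> nat set) \<Rightarrow> bool" where
  "list_colourable r G X L \<longleftrightarrow>
     (\<exists>\<phi>. (\<forall>v\<in>X. \<phi> v \<in> L v) \<and>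
          (\<forall>u\<in>X. \<forall>v\<in>X. \<phi> u = \<phi> v \<longrightarrow> \<not> conflict r G (\<phi> u) u v))"

definition induced_subgraph :: "graph \<Rightarrow> nat set \<Rightarrow> graph" where
  "induced_subgraph G X = \<lparr>verts = X, edges = edges G \<inter> Pow X\<rparr>"

lemma colourable_iff_colouring:
  "colourable r s H \<longleftrightarrow> list_colourable r H (verts H) (\<lambda>_. {..<r + s})"
proof
  assume "colourable r s H"
  then obtain P :: "nat \<Rightarrow> nat set" where disj: "disjoint_family_on P {..<r + s}"
    and un: "(\<Union>i<r + s. P i) = verts H"
    and ind: "\<forall>i<r. indep (P i) (edges H)" and cli: "\<forall>i\<in>{r..<r + s}. clique (P i) (edges H)"
    unfolding colourable_def by blast
  have "\<forall>v\<in>verts H. \<exists>i<r + s. v \<in> P i"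
    using un by auto
  then obtain \<phi> where \<phi>: "\<forall>v\<in>verts H. \<phi> v < r + s \<and> v \<in> P (\<phi> v)"
    by metis
  have "\<not> conflict r H (\<phi> u) u v" if "u \<in> verts H" "v \<in> verts H" "\<phi> u = \<phi> v" for u v
  proof (cases "\<phi> u < r")
    case True
    then have "indep (P (\<phi> u)) (edges H)"
      using ind by blast
    moreover have "u \<in> P (\<phi> u)" "v \<in> P (\<phi> u)"
      using \<phi> that by auto
    ultimately show ?thesis
      using True by (auto simp: conflict_def indep_def)
  next
    case False
    then have "clique (P (\<phi> u)) (edges H)"
      using cli \<phi> that by auto
    moreover have "u \<in> P (\<phi> u)" "v \<in> P (\<phi> u)"
      using \<phi> that by auto
    ultimately show ?thesis
      using False by (auto simp: conflict_def clique_def)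
  qed
  then show "list_colourable r H (verts H) (\<lambda>_. {..<r + s})"
    unfolding list_colourable_def using \<phi> by (intro exI[of _ \<phi>]) auto
next
  assume "list_colourable r H (verts H) (\<lambda>_. {..<r + s})"
  then obtain \<phi> where \<phi>: "\<forall>v\<in>verts H. \<phi> v < r + s"
    "\<forall>u\<in>verts H. \<forall>v\<in>verts H. \<phi> u = \<phi> v \<longrightarrow> \<not> conflict r H (\<phi> u) u v"
    unfolding list_colourable_def by auto
  then show "colourable r s H"
    unfolding colourable_def
    by (intro exI[of _ "\<lambda>i. {v \<in> verts H. \<phi> v = i}"])
       (auto simp: disjoint_family_on_def indep_def clique_def conflict_def; metis not_le)
qed

lemma colourable_induced_subgraph_iff:
  "colourable r s (induced_subgraph G X) \<longleftrightarrow> list_colourable r G X (\<lambda>_. {..<r + s})"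
proof -
  have "conflict r (induced_subgraph G X) i u v \<longleftrightarrow> conflict r G i u v" if "u \<in> X" "v \<in> X" for i u v
    using that by (auto simp: conflict_def induced_subgraph_def)
  then show ?thesis
    unfolding colourable_iff_colouring list_colourable_def
    by (simp add: induced_subgraph_def cong: ball_cong)
qed

lemma list_colourable_mono:
  "list_colourable r G Y L \<Longrightarrow> X \<subseteq> Y \<Longrightarrow> list_colourable r G X L"
  unfolding list_colourable_def by blast


section \<open>Restricting vertices\<close>

text \<open>The vertices that lose the colour \<open>i\<close> from their lists once \<open>v\<close> is given that colour.\<close>

definition spoiled :: "nat \<Rightarrow> graph \<Rightarrow> (nat \<Rightarrow> nat set) \<Rightarrow> nat \<Rightarrow> nat \<Rightarrow> nat set" where
  "spoiled r G L v i = {u \<in> verts G. i \<in> L u \<and> conflict r G i u v}"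

definition restricting :: "nat \<Rightarrow> graph \<Rightarrow> real \<Rightarrow> (nat \<Rightarrow> nat set) \<Rightarrow> nat set" where
  "restricting r G \<delta> L =
     {v \<in> verts G. \<forall>i\<in>L v. \<delta> * card (verts G) \<le> card (spoiled r G L v i)}"

definition prune :: "nat \<Rightarrow> graph \<Rightarrow> (nat \<Rightarrow> nat set) \<Rightarrow> nat \<Rightarrow> nat \<Rightarrow> nat \<Rightarrow> nat set" where
  "prune r G L v i u = (if conflict r G i u v then L u - {i} else L u)"

definition list_weight :: "graph \<Rightarrow> (nat \<Rightarrow> nat set) \<Rightarrow> nat" where
  "list_weight G L = (\<Sum>u\<in>verts G. card (L u))"

text \<open>Each spoiled vertex loses exactly one list entry, which makes the weight a potential.\<close>

lemma list_weight_prune: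
  assumes "finite (verts G)" "\<And>u. finite (L u)"
  shows "list_weight G (prune r G L v i) + card (spoiled r G L v i) = list_weight G L"
proof -
  have "card (L u) = card (prune r G L v i u) + (if u \<in> spoiled r G L v i then 1 else 0)"
    if "u \<in> verts G" for u
    using that assms(2)[of u] card_Suc_Diff1[of "L u" i]
    by (auto simp: prune_def spoiled_def)
  then have "list_weight G L =
      (\<Sum>u\<in>verts G. card (prune r G L v i u) + (if u \<in> spoiled r G L v i then 1 else 0))"
    unfolding list_weight_def by (intro sum.cong) auto
  also have "\<dots> = list_weight G (prune r G L v i) + card (verts G \<inter> spoiled r G L v i)"
    using assms(1) by (simp add: list_weight_def sum.distrib sum.If_cases)
  also have "verts G \<inter> spoiled r G L v i = spoiled r G L v i"
    by (auto simp: spoiled_def)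
  finally show ?thesis by simp
qed

text \<open>A colouring that gives \<open>v\<close> the colour \<open>i\<close> respects the lists pruned by this choice. This also covers
  \<open>v \<in> X\<close>, since no vertex is in conflict with itself.\<close>

lemma list_colourable_insertD:
  assumes "list_colourable r G (insert v X) L"
  obtains i where "i \<in> L v" "list_colourable r G X (prune r G L v i)"
proof -
  from assms obtain \<phi> where \<phi>: "\<forall>u\<in>insert v X. \<phi> u \<in> L u"
    "\<forall>u\<in>insert v X. \<forall>w\<in>insert v X. \<phi> u = \<phi> w \<longrightarrow> \<not> conflict r G (\<phi> u) u w"
    unfolding list_colourable_def by blast
  have "\<phi> u \<in> prune r G L v (\<phi> v) u" if "u \<in> X" for u
    using \<phi> that by (auto simp: prune_def)
  then have "list_colourable r G X (prune r G L v (\<phi> v))"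
    unfolding list_colourable_def using \<phi>(2) by blast
  then show ?thesis
    using that \<phi>(1) by blast
qed

text \<open>Otherwise give each vertex outside the set \<open>R\<close> of restricting vertices a colour spoiling few others,
  and colour \<open>R\<close> arbitrarily. A violated pair either meets \<open>R\<close>, or joins a vertex \<open>v\<close> to a vertex
  spoiled by the choice at \<open>v\<close>. Each kind accounts for at most \<open>\<epsilon> / 2 * n\<^sup>2\<close> pairs, so the graph is not
  far.\<close>

lemma many_restricting_vertices_if_far:
  assumes G: "simple_graph G" and far: "far_from \<epsilon> (colourable_graphs r s) G"
    and "\<epsilon> > 0" "r + s \<ge> 1" and L: "\<And>v. L v \<subseteq> {..<r + s}"
  shows "\<epsilon> / 2 * card (verts G) \<le> card (restricting r G (\<epsilon> / 2) L)"
proof (rule ccontr)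
  define V where "V = verts G"
  define n where "n = real (card V)"
  define R where "R = restricting r G (\<epsilon> / 2) L"
  assume "\<not> ?thesis"
  then have R: "card R < \<epsilon> / 2 * n"
    by (simp add: V_def n_def R_def)
  have finV: "finite V"
    using G by (simp add: simple_graph_def V_def)
  have RV: "R \<subseteq> V"
    by (auto simp: R_def V_def restricting_def)
  have "\<forall>v\<in>V - R. \<exists>i. i \<in> L v \<and> card (spoiled r G L v i) < \<epsilon> / 2 * n"
    unfolding R_def restricting_def V_def n_def by fastforce
  then obtain f where f: "\<forall>v\<in>V - R. f v \<in> L v \<and> card (spoiled r G L v (f v)) < \<epsilon> / 2 * n"
    by metis
  define \<phi> where "\<phi> v = (if v \<in> V - R then f v else 0)" for v
  have \<phi>: "\<phi> v < r + s" for v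
    using f L[of v] \<open>r + s \<ge> 1\<close> by (auto simp: \<phi>_def)
  \<comment> \<open>The closest graph for which \<open>\<phi>\<close> is a proper colouring: pairs inside a colour class
    are repaired, all others are kept.\<close>
  define E' where "E' = {e. \<exists>u v. e = {u, v} \<and> u \<in> V \<and> v \<in> V \<and> u \<noteq> v \<and>
    (if \<phi> u = \<phi> v then r \<le> \<phi> u else {u, v} \<in> edges G)}"
  define G' where "G' = \<lparr>verts = V, edges = E'\<rparr>"
  have mem_E': "{u, v} \<in> E' \<longleftrightarrow> (if \<phi> u = \<phi> v then r \<le> \<phi> u else {u, v} \<in> edges G)"
    if "u \<in> V" "v \<in> V" "u \<noteq> v" for u v
    using that insert_commute[of u v "{}"] unfolding E'_def mem_Collect_eq
    by (metis doubleton_eq_iff)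
  have "simple_graph G'"
    using finV by (auto simp: simple_graph_def G'_def E'_def)
  moreover have "list_colourable r G' (verts G') (\<lambda>_. {..<r + s})"
    unfolding list_colourable_def
    by (intro exI[of _ \<phi>]) (use \<phi> in \<open>auto simp: G'_def conflict_def mem_E'\<close>)
  ultimately have G': "G' \<in> colourable_graphs r s"
    by (simp add: colourable_graphs_def colourable_iff_colouring)
  \<comment> \<open>Ordered pairs covering every violated edge or non-edge, split as described above.\<close>
  define M where "M = Sigma R (\<lambda>_. V) \<union> Sigma (V - R) (\<lambda>v. spoiled r G L v (f v))"
  have spoil: "spoiled r G L v i \<subseteq> V" for v i
    by (auto simp: spoiled_def V_def)
  have finM: "finite M"
    using finV finite_subset[OF RV finV] finite_subset[OF spoil finV] by (auto simp: M_def)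
  have "sym_diff (edges G) E' \<subseteq> (\<lambda>(v, u). {v, u}) ` M"
  proof
    fix e assume e: "e \<in> sym_diff (edges G) E'"
    have "E' \<subseteq> nsets V 2"
      by (auto simp: E'_def)
    then have "e \<in> nsets V 2"
      using e G by (auto simp: simple_graph_def V_def)
    then obtain u v where uv: "e = {u, v}" "u \<in> V" "v \<in> V" "u \<noteq> v"
      by (auto simp: nsets_2_eq)
    have eq: "\<phi> u = \<phi> v" and con: "({u, v} \<in> edges G) \<noteq> (r \<le> \<phi> u)"
      using e uv mem_E'[of u v] by (auto split: if_splits)
    have "(u, v) \<in> M \<or> (v, u) \<in> M"
    proof (cases "u \<in> R \<or> v \<in> R")
      case True
      then show ?thesis using uv by (auto simp: M_def)
    next
      case False
      then have "\<phi> u = f u" "f u = f v"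
        using uv eq by (auto simp: \<phi>_def)
      moreover have "f u \<in> L u"
        using f uv False by blast
      ultimately have "u \<in> spoiled r G L v (f v)"
        using uv con by (simp add: spoiled_def V_def conflict_def)
      then show ?thesis using False uv by (auto simp: M_def)
    qed
    then show "e \<in> (\<lambda>(v, u). {v, u}) ` M"
      using uv(1) by (auto intro: rev_image_eqI)
  qed
  then have "card (sym_diff (edges G) E') \<le> card M"
    by (rule surj_card_le[OF finM])
  also have "card M \<le> card R * card V + (\<Sum>v\<in>V - R. card (spoiled r G L v (f v)))"
    unfolding M_def
    by (rule order.trans[OF card_Un_le])
       (use finV finite_subset[OF RV finV] finite_subset[OF spoil finV] in
         \<open>simp add: card_SigmaI\<close>)
  finally have "real (card (sym_diff (edges G) E')) \<le>
      real (card R * card V + (\<Sum>v\<in>V - R. card (spoiled r G L v (f v))))"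
    by (rule of_nat_mono)
  also have "\<dots> = card R * n + (\<Sum>v\<in>V - R. real (card (spoiled r G L v (f v))))"
    by (simp add: n_def)
  also have "(\<Sum>v\<in>V - R. real (card (spoiled r G L v (f v)))) \<le> card (V - R) * (\<epsilon> / 2 * n)"
    using f by (intro sum_bounded_above) (auto intro: less_imp_le)
  also have "\<dots> \<le> n * (\<epsilon> / 2 * n)"
    using finV \<open>\<epsilon> > 0\<close> by (intro mult_right_mono) (auto simp: n_def intro: card_mono)
  also have "card R * n \<le> (\<epsilon> / 2 * n) * n"
    using R by (intro mult_right_mono) (auto simp: n_def)
  finally have "real (card (sym_diff (edges G) E')) \<le> \<epsilon> * n\<^sup>2"
    by (simp add: power2_eq_square algebra_simps)
  then have "graph_dist G G' \<le> \<epsilon>"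
    using \<open>\<epsilon> > 0\<close> by (cases "n = 0") (auto simp: graph_dist_def G'_def n_def V_def field_simps)
  moreover have "(INF G'\<in>{G' \<in> colourable_graphs r s. verts G' = verts G}. ereal (graph_dist G G'))
      \<le> ereal (graph_dist G G')"
    using G' by (intro INF_lower) (auto simp: G'_def V_def)
  ultimately show False
    using far unfolding far_from_def by (meson ereal_less_eq(3) leD order.trans)
qed


section \<open>The probability that a sample is colourable\<close>

lemma prob_replicate_pmf_Suc:
  assumes "finite V" "V \<noteq> {}"
  shows "measure_pmf.prob (replicate_pmf (Suc t) (pmf_of_set V)) A =
    (\<Sum>v\<in>V. measure_pmf.prob (replicate_pmf t (pmf_of_set V)) {xs. v # xs \<in> A}) / card V"
proof -
  let ?p = "replicate_pmf t (pmf_of_set V)"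
  have "replicate_pmf (Suc t) (pmf_of_set V) = pmf_of_set V \<bind> (\<lambda>v. map_pmf ((#) v) ?p)"
    by (simp add: map_pmf_def)
  then have "ennreal (measure_pmf.prob (replicate_pmf (Suc t) (pmf_of_set V)) A) =
      (\<integral>\<^sup>+v. ennreal (measure_pmf.prob ?p {xs. v # xs \<in> A}) \<partial>pmf_of_set V)"
    by (simp add: measure_pmf.emeasure_eq_measure[symmetric] vimage_def del: replicate_pmf.simps)
  also have "\<dots> = ennreal (measure_pmf.expectation (pmf_of_set V)
      (\<lambda>v. measure_pmf.prob ?p {xs. v # xs \<in> A}))"
    by (intro nn_integral_eq_integral measure_pmf.integrable_const_bound[where B=1]) auto
  finally show ?thesis
    using assms
    by (subst (asm) ennreal_inj) (auto simp: integral_pmf_of_set intro!: sum_nonneg divide_nonneg_nonneg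
      simp del: replicate_pmf.simps)
qed

text \<open>The induction reveals the first sample \<open>v\<close>. If \<open>v\<close> is not restricting, it is simply discarded and the
  bound for the same lists is kept. If it is, the bound for the pruned lists is smaller by a factor
  \<open>2 k\<close> for each of the at most \<open>k\<close> colours, so their sum is at most half the old bound. Averaging over
  \<open>v\<close> gives the factor \<open>1 - \<delta> / 2\<close>. The hypothesis on restricting vertices ranges over
  all lists because pruning changes them.\<close>

lemma prob_list_colourable_le:
  fixes \<delta> :: real
  assumes G: "finite (verts G)" "verts G \<noteq> {}" and k: "k \<ge> 1" and \<delta>: "0 < \<delta>" "\<delta> \<le> 1"
    and many: "\<And>L. (\<And>v. L v \<subseteq> {..<k}) \<Longrightarrow> \<delta> * card (verts G) \<le> card (restricting r G \<delta> L)"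
    and L: "\<And>v. L v \<subseteq> {..<k}"
  shows "measure_pmf.prob (replicate_pmf t (pmf_of_set (verts G)))
           {xs. list_colourable r G (set xs) L}
         \<le> (2 * real k) powr (list_weight G L / (\<delta> * card (verts G))) * (1 - \<delta> / 2) ^ t"
  using L
proof (induction t arbitrary: L)
  case 0
  have "1 \<le> (2 * real k) powr (list_weight G L / (\<delta> * card (verts G)))"
    using k \<delta> by (intro ge_one_powr_ge_zero) auto
  then show ?case
    by (auto simp: indicator_def)
next
  case (Suc t)
  let ?V = "verts G"
  let ?p = "replicate_pmf t (pmf_of_set ?V)"
  let ?R = "restricting r G \<delta> L"
  define n where "n = real (card ?V)"
  define b where "b L = (2 * real k) powr (list_weight G L / (\<delta> * n)) * (1 - \<delta> / 2) ^ t" for L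
  have n: "n > 0"
    using G by (simp add: n_def card_gt_0_iff)
  have b_nonneg: "b L' \<ge> 0" for L'
    using \<delta> by (simp add: b_def)
  have RV: "?R \<subseteq> ?V"
    by (auto simp: restricting_def)
  have IH: "measure_pmf.prob ?p {xs. list_colourable r G (set xs) L'} \<le> b L'"
    if "\<And>v. L' v \<subseteq> {..<k}" for L'
    using Suc.IH[OF that] by (simp add: b_def n_def)
  let ?q = "\<lambda>v. measure_pmf.prob ?p {xs. list_colourable r G (insert v (set xs)) L}"
  have keep: "?q v \<le> b L" for v
    by (rule order.trans[OF measure_pmf.finite_measure_mono IH[OF Suc.prems]])
       (auto elim: list_colourable_mono)
  have halve: "?q v \<le> b L / 2" if v: "v \<in> ?R" for v
  proof -
    have pruned: "b (prune r G L v i) \<le> b L / (2 * real k)" if i: "i \<in> L v" for i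
    proof -
      have "\<delta> * n \<le> card (spoiled r G L v i)"
        using v i by (simp add: restricting_def n_def)
      moreover have "real (list_weight G (prune r G L v i)) + card (spoiled r G L v i) = list_weight G L"
        using list_weight_prune[of G L r v i] G(1) finite_subset[OF Suc.prems]
        by (metis finite_lessThan of_nat_add)
      ultimately have "list_weight G (prune r G L v i) / (\<delta> * n) \<le> list_weight G L / (\<delta> * n) - 1"
        using \<delta> n by (simp add: field_simps)
      then have "(2 * real k) powr (list_weight G (prune r G L v i) / (\<delta> * n))
          \<le> (2 * real k) powr (list_weight G L / (\<delta> * n) - 1)"
        using k by (intro powr_mono) auto
      also have "\<dots> = (2 * real k) powr (list_weight G L / (\<delta> * n)) / (2 * real k)"
        using k by (subst powr_diff) simp
      finally have "b (prune r G L v i) \<le>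
          (2 * real k) powr (list_weight G L / (\<delta> * n)) / (2 * real k) * (1 - \<delta> / 2) ^ t"
        unfolding b_def using \<delta> by (intro mult_right_mono) auto
      then show ?thesis
        by (simp add: b_def)
    qed
    have "?q v \<le> measure_pmf.prob ?p (\<Union>i\<in>L v. {xs. list_colourable r G (set xs) (prune r G L v i)})"
      by (intro measure_pmf.finite_measure_mono) (auto elim: list_colourable_insertD)
    also have "\<dots> \<le> (\<Sum>i\<in>L v. measure_pmf.prob ?p {xs. list_colourable r G (set xs) (prune r G L v i)})"
      using finite_subset[OF Suc.prems] by (intro measure_UNION_le) auto
    also have "\<dots> \<le> (\<Sum>i\<in>L v. b L / (2 * real k))"
    proof (rule sum_mono)
      fix i assume "i \<in> L v"
      moreover have "prune r G L v i u \<subseteq> {..<k}" for u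
        using Suc.prems[of u] by (auto simp: prune_def)
      ultimately show "measure_pmf.prob ?p {xs. list_colourable r G (set xs) (prune r G L v i)}
          \<le> b L / (2 * real k)"
        using IH pruned order.trans by blast
    qed
    also have "\<dots> = card (L v) * (b L / (2 * real k))"
      by simp
    also have "\<dots> \<le> k * (b L / (2 * real k))"
      using card_mono[OF _ Suc.prems[of v]] b_nonneg k by (intro mult_right_mono) auto
    finally show ?thesis
      using k by simp
  qed
  have "(\<Sum>v\<in>?V. ?q v) = (\<Sum>v\<in>?V - ?R. ?q v) + (\<Sum>v\<in>?R. ?q v)"
    by (rule sum.subset_diff[OF RV G(1)])
  also have "\<dots> \<le> card (?V - ?R) * b L + card ?R * (b L / 2)"
    using keep halve by (intro add_mono sum_bounded_above) auto
  also have "real (card (?V - ?R)) = n - card ?R"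
    using G RV by (simp add: card_Diff_subset finite_subset n_def card_mono of_nat_diff)
  also have "(n - card ?R) * b L + card ?R * (b L / 2) = b L * (n - card ?R / 2)"
    by (simp add: algebra_simps)
  also have "\<dots> \<le> b L * (n - \<delta> * n / 2)"
    using many[OF Suc.prems] b_nonneg by (intro mult_left_mono) (auto simp: n_def)
  finally have "(\<Sum>v\<in>?V. ?q v) / n \<le> b L * (1 - \<delta> / 2)"
    using n by (simp add: field_simps)
  then show ?case
    using G by (simp add: prob_replicate_pmf_Suc b_def n_def ac_simps del: replicate_pmf.simps)
qed

lemma not_member_if_far:
  assumes "far_from \<epsilon> \<P> G" "\<epsilon> > 0"
  shows "G \<notin> \<P>"
proof
  assume "G \<in> \<P>"
  then have "(INF G'\<in>{G' \<in> \<P>. verts G' = verts G}. ereal (graph_dist G G'))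
      \<le> ereal (graph_dist G G)"
    by (intro INF_lower) auto
  also have "\<dots> \<le> ereal \<epsilon>"
    using assms(2) by (simp add: graph_dist_def)
  finally show False
    using assms(1) by (simp add: far_from_def)
qed

lemma nonempty_if_far:
  assumes "simple_graph G" "far_from \<epsilon> (colourable_graphs r s) G" "\<epsilon> > 0"
  shows "verts G \<noteq> {}"
  using not_member_if_far[OF assms(2,3)] assms(1)
  by (auto simp: colourable_graphs_def colourable_iff_colouring list_colourable_def)

text \<open>For empty lists all vertices are restricting, and there are only \<open>n\<close> of them.\<close>

lemma le_2_if_far:
  assumes "simple_graph G" "far_from \<epsilon> (colourable_graphs r s) G" "\<epsilon> > 0" "r + s \<ge> 1"
  shows "\<epsilon> \<le> 2"
proof -
  let ?R = "restricting r G (\<epsilon> / 2) (\<lambda>_. {})"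
  have fin: "finite (verts G)"
    using assms(1) by (simp add: simple_graph_def)
  have "\<epsilon> / 2 * card (verts G) \<le> card ?R"
    using assms by (intro many_restricting_vertices_if_far) auto
  also have "\<dots> \<le> card (verts G)"
    using fin by (auto simp: restricting_def intro: card_mono)
  finally show ?thesis
    using nonempty_if_far[OF assms(1-3)] fin by (simp add: card_gt_0_iff)
qed

text \<open>Chosen so that, for \<open>\<epsilon> \<le> 2\<close>, \<open>(2 k) powr (2 k / \<epsilon>) * (1 - \<epsilon> / 4) ^ t \<le> exp (- 2)\<close> for every
  \<open>t\<close> that is at least the sample size: the initial weight \<open>k n\<close>, divided by \<open>\<epsilon> / 2 * n\<close>, is
  \<open>2 k / \<epsilon>\<close>.\<close>

definition sample_size :: "nat \<Rightarrow> real \<Rightarrow> nat" where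
  "sample_size k \<epsilon> = nat \<lceil>4 / \<epsilon> * (2 * k / \<epsilon> * ln (2 * k) + 2)\<rceil>"

lemma prob_sample_colourable_le_third:
  assumes G: "simple_graph G" and far: "far_from \<epsilon> (colourable_graphs r s) G"
    and \<epsilon>: "\<epsilon> > 0" and k: "r + s \<ge> 1" and t: "sample_size (r + s) \<epsilon> \<le> t"
  shows "measure_pmf.prob (replicate_pmf t (pmf_of_set (verts G)))
           {xs. list_colourable r G (set xs) (\<lambda>_. {..<r + s})} \<le> 1 / 3"
proof -
  let ?k = "real (r + s)"
  have fin: "finite (verts G)" and ne: "verts G \<noteq> {}"
    using G nonempty_if_far[OF G far \<epsilon>] by (auto simp: simple_graph_def)
  have \<epsilon>2: "\<epsilon> \<le> 2"
    by (rule le_2_if_far[OF G far \<epsilon> k])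
  have n: "real (card (verts G)) > 0"
    using fin ne by (simp add: card_gt_0_iff)
  have "real (list_weight G (\<lambda>_. {..<r + s})) / (\<epsilon> / 2 * card (verts G)) = 2 * ?k / \<epsilon>"
    using n \<epsilon> by (simp add: list_weight_def field_simps)
  then have "measure_pmf.prob (replicate_pmf t (pmf_of_set (verts G)))
           {xs. list_colourable r G (set xs) (\<lambda>_. {..<r + s})}
      \<le> (2 * ?k) powr (2 * ?k / \<epsilon>) * (1 - \<epsilon> / 2 / 2) ^ t"
    using prob_list_colourable_le[OF fin ne k _ _ many_restricting_vertices_if_far[OF G far \<epsilon> k],
        of "\<lambda>_. {..<r + s}" t] \<epsilon> \<epsilon>2 by simp
  also have "(1 - \<epsilon> / 2 / 2) ^ t \<le> exp (- (\<epsilon> / 4)) ^ t"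
    using exp_ge_add_one_self[of "- (\<epsilon> / 4)"] \<epsilon>2 by (intro power_mono) auto
  also have "\<dots> = exp (- (\<epsilon> / 4 * t))"
    by (simp add: exp_of_nat_mult[symmetric] mult.commute)
  also have "(2 * ?k) powr (2 * ?k / \<epsilon>) = exp (2 * ?k / \<epsilon> * ln (2 * ?k))"
    using k by (simp add: powr_def)
  also have "exp (2 * ?k / \<epsilon> * ln (2 * ?k)) * exp (- (\<epsilon> / 4 * t)) =
      exp (2 * ?k / \<epsilon> * ln (2 * ?k) - \<epsilon> / 4 * t)"
    by (simp add: exp_add[symmetric])
  also have "\<dots> \<le> exp (- 2)"
  proof -
    have "4 / \<epsilon> * (2 * ?k / \<epsilon> * ln (2 * ?k) + 2) \<le> t"
      using t by (simp add: sample_size_def nat_le_iff ceiling_le_iff)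
    then have "2 * ?k / \<epsilon> * ln (2 * ?k) + 2 \<le> \<epsilon> / 4 * t"
      using \<epsilon> by (simp add: field_simps)
    then show ?thesis by simp
  qed
  also have "\<dots> \<le> 1 / 3"
    using exp_ge_add_one_self[of 2] by (simp add: exp_minus divide_simps)
  finally show ?thesis by (simp add: mult_left_mono)
qed


section \<open>The tester\<close>

text \<open>The argument \<open>E\<close> accumulates the edges found so far; the predicate \<open>f\<close> gives the verdict on the
  final set.\<close>

primrec query_pairs ::
  "(nat \<times> nat) list \<Rightarrow> nat set set \<Rightarrow> (nat set set \<Rightarrow> bool) \<Rightarrow> algorithm" where
  "query_pairs [] E f = Verdict (f E)"
| "query_pairs (p # ps) E f =
     Query (fst p) (snd p) (\<lambda>b. query_pairs ps (if b then insert {fst p, snd p} E else E) f)"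

definition colour_tester :: "nat \<Rightarrow> nat \<Rightarrow> nat \<Rightarrow> algorithm" where
  "colour_tester r s t =
     Sample t (\<lambda>xs. query_pairs (List.product xs xs) {}
                      (\<lambda>E. colourable r s \<lparr>verts = set xs, edges = E\<rparr>))"

lemma run_query_pairs:
  "run G (query_pairs ps E f) =
     return_pmf (f (E \<union> {{u, v} | u v. (u, v) \<in> set ps \<and> {u, v} \<in> edges G}), length ps, 0)"
proof (induction ps arbitrary: E)
  case (Cons p ps)
  have "(if {fst p, snd p} \<in> edges G then insert {fst p, snd p} E else E) \<union>
      {{u, v} | u v. (u, v) \<in> set ps \<and> {u, v} \<in> edges G} =
      E \<union> {{u, v} | u v. (u, v) \<in> set (p # ps) \<and> {u, v} \<in> edges G}"
    by (cases p) auto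
  then show ?case
    by (simp only: query_pairs.simps run.simps Cons.IH map_return_pmf) simp
qed simp

lemma run_colour_tester:
  assumes "simple_graph G"
  shows "run G (colour_tester r s t) =
    map_pmf (\<lambda>xs. (list_colourable r G (set xs) (\<lambda>_. {..<r + s}), (length xs)\<^sup>2, length xs))
      (sample_oracle G t)"
proof -
  have "{{u, v} | u v. u \<in> X \<and> v \<in> X \<and> {u, v} \<in> edges G} = edges G \<inter> Pow X" for X
    using assms by (force simp: simple_graph_def nsets_2_eq)
  then have "colourable r s \<lparr>verts = X, edges = {{u, v} | u v. u \<in> X \<and> v \<in> X \<and> {u, v} \<in> edges G}\<rparr>
      \<longleftrightarrow> list_colourable r G X (\<lambda>_. {..<r + s})" for X
    using colourable_induced_subgraph_iff[of r s G X] by (simp add: induced_subgraph_def)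
  then show ?thesis
    by (simp add: colour_tester_def run_query_pairs map_pmf_def bind_assoc_pmf bind_return_pmf
        power2_eq_square conj_assoc)
qed

lemma set_sample_oracle:
  assumes "finite (verts G)" "t \<ge> 1" "xs \<in> set_pmf (sample_oracle G t)"
  shows "set xs \<subseteq> verts G" "length xs \<le> t"
proof -
  have "set xs \<subseteq> verts G \<and> length xs \<le> t"
  proof (cases "t > card (verts G)")
    case True
    with assms show ?thesis by (simp add: sample_oracle_def)
  next
    case False
    with assms have "verts G \<noteq> {}" by auto
    with False assms show ?thesis by (auto simp: sample_oracle_def set_replicate_pmf)
  qed
  then show "set xs \<subseteq> verts G" "length xs \<le> t" by auto
qed

lemma accept_prob_colour_tester:
  assumes "G \<in> colourable_graphs r s" "t \<ge> 1"
  shows "accept_prob G (colour_tester r s t) = 1"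
proof -
  have G: "simple_graph G" "list_colourable r G (verts G) (\<lambda>_. {..<r + s})"
    using assms by (auto simp: colourable_graphs_def colourable_iff_colouring)
  then have "finite (verts G)"
    by (simp add: simple_graph_def)
  then have "AE xs in sample_oracle G t. list_colourable r G (set xs) (\<lambda>_. {..<r + s})"
    using set_sample_oracle(1)[OF _ assms(2)] list_colourable_mono[OF G(2)]
    by (auto simp: AE_measure_pmf_iff)
  then show ?thesis
    using G by (simp add: accept_prob_def run_colour_tester vimage_def measure_pmf.prob_eq_1)
qed

text \<open>If the request exceeds the graph, the verdict is exact, and a far graph is not colourable.
  Otherwise the sample consists of independent uniform vertices.\<close>

lemma reject_prob_colour_tester:
  assumes G: "simple_graph G" and far: "far_from \<epsilon> (colourable_graphs r s) G"
    and \<epsilon>: "\<epsilon> > 0" and k: "r + s \<ge> 1" and t: "sample_size (r + s) \<epsilon> \<le> t"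
  shows "reject_prob G (colour_tester r s t) \<ge> 2 / 3"
proof -
  let ?A = "{xs. list_colourable r G (set xs) (\<lambda>_. {..<r + s})}"
  have "measure_pmf.prob (sample_oracle G t) ?A \<le> 1 / 3"
  proof (cases "t > card (verts G)")
    case True
    have "\<not> list_colourable r G (verts G) (\<lambda>_. {..<r + s})"
      using not_member_if_far[OF far \<epsilon>] G by (simp add: colourable_graphs_def colourable_iff_colouring)
    then show ?thesis
      using True G by (simp add: sample_oracle_def simple_graph_def)
  next
    case False
    then show ?thesis
      using prob_sample_colourable_le_third[OF G far \<epsilon> k t] by (simp add: sample_oracle_def)
  qed
  moreover have "measure_pmf.prob (sample_oracle G t) (- ?A) = 1 - measure_pmf.prob (sample_oracle G t) ?A"
    using measure_pmf.prob_compl[of ?A "sample_oracle G t"] by (simp add: Compl_eq_Diff_UNIV)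
  ultimately show ?thesis
    using G by (simp add: reject_prob_def run_colour_tester vimage_def Collect_neg_eq)
qed

lemma complexity_colour_tester:
  assumes "t \<ge> 1"
  shows "query_complexity (colour_tester r s t) \<le> enat (t\<^sup>2)"
    and "sample_complexity (colour_tester r s t) \<le> enat t"
proof -
  have "q \<le> t\<^sup>2 \<and> l \<le> t" if "simple_graph G" "(b, q, l) \<in> set_pmf (run G (colour_tester r s t))"
    for G b q l
    using that assms set_sample_oracle(2)[of G t]
    by (auto simp: run_colour_tester simple_graph_def intro!: power_mono)
  then show "query_complexity (colour_tester r s t) \<le> enat (t\<^sup>2)"
    and "sample_complexity (colour_tester r s t) \<le> enat t"
    unfolding query_complexity_def sample_complexity_def
    by (auto intro!: SUP_least)
qed

lemma sample_size_pos:
  assumes "\<epsilon> > 0" "k \<ge> 1"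
  shows "sample_size k \<epsilon> \<ge> 1"
proof -
  have "0 < 4 / \<epsilon> * (2 * k / \<epsilon> * ln (2 * k) + 2)"
    using assms by (intro mult_pos_pos add_nonneg_pos) auto
  then show ?thesis
    by (simp add: sample_size_def) linarith
qed

text \<open>Everything is expressed by \<open>x = k / \<epsilon>\<close>. As \<open>2 k = 2 \<epsilon> x \<le> 4 x \<le> (2 + x)\<^sup>2\<close>, the
  logarithm of \<open>2 k\<close> is at most twice that of \<open>2 + x\<close>. Since \<open>x\<close> and \<open>ln (2 + x)\<close> are at least
  \<open>1 / 2\<close>, the terms of lower order are absorbed into the leading one.\<close>

lemma sample_size_le:
  fixes x :: real
  assumes \<epsilon>: "0 < \<epsilon>" "\<epsilon> \<le> 2" and k: "k \<ge> 1"
  defines "x \<equiv> real k / \<epsilon>"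
  shows "sample_size k \<epsilon> \<le> 56 * (x\<^sup>2 * ln (2 + x))"
proof -
  define l where "l = ln (2 + x)"
  have x: "1 / 2 \<le> x" "1 / \<epsilon> \<le> x"
    using assms by (auto simp: x_def field_simps)
  have l: "1 / 2 \<le> l"
  proof -
    have "- l = ln (inverse (2 + x))"
      using x by (simp add: l_def ln_inverse)
    also have "\<dots> \<le> inverse (2 + x) - 1"
      using x by (intro ln_le_minus_one) auto
    also have "\<dots> \<le> - (1 / 2)"
      using x by (simp add: field_simps)
    finally show ?thesis by simp
  qed
  have "2 * real k = 2 * \<epsilon> * x"
    using \<epsilon> by (simp add: x_def)
  also have "\<dots> \<le> 4 * x"
    using \<epsilon> x by simp
  also have "\<dots> \<le> (2 + x)\<^sup>2"
    by (simp add: power2_eq_square algebra_simps)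
  finally have "ln (2 * real k) \<le> ln ((2 + x)\<^sup>2)"
    using k x by (subst ln_le_cancel_iff) auto
  then have lnk: "ln (2 * real k) \<le> 2 * l"
    using x by (simp add: l_def ln_realpow)
  have "4 / \<epsilon> * (2 * k / \<epsilon> * ln (2 * k) + 2) = 4 * (1 / \<epsilon>) * (2 * x * ln (2 * k) + 2)"
    by (simp add: x_def)
  also have "\<dots> \<le> 4 * x * (2 * x * (2 * l) + 2)"
    using x lnk k \<epsilon> by (intro mult_mono add_mono order.refl add_nonneg_nonneg) auto
  finally have "4 / \<epsilon> * (2 * k / \<epsilon> * ln (2 * k) + 2) \<le> 16 * (x\<^sup>2 * l) + 8 * x"
    by (simp add: power2_eq_square algebra_simps)
  moreover have "real (sample_size k \<epsilon>) \<le> 4 / \<epsilon> * (2 * k / \<epsilon> * ln (2 * k) + 2) + 1"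
    using sample_size_pos[OF \<epsilon>(1) k] unfolding sample_size_def by linarith
  moreover have "x \<le> 4 * (x\<^sup>2 * l)"
  proof -
    have "1 * 1 \<le> (2 * x) * (2 * l)"
      using x l by (intro mult_mono) auto
    then have "x * 1 \<le> x * ((2 * x) * (2 * l))"
      using x by (intro mult_left_mono) auto
    then show ?thesis by (simp add: power2_eq_square ac_simps)
  qed
  ultimately show ?thesis
    using x unfolding l_def by linarith
qed

lemma sample_size_squared_le:
  assumes \<epsilon>: "0 < \<epsilon>" "\<epsilon> \<le> 2" and k: "k \<ge> 1"
  shows "real ((sample_size k \<epsilon>)\<^sup>2) \<le> 12544 * (real k ^ 6 / \<epsilon> ^ 6) * ln (2 + real k / \<epsilon>) ^ 2"
proof -
  define x where "x = real k / \<epsilon>"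
  have x: "1 / 2 \<le> x"
    using assms by (auto simp: x_def field_simps)
  have "real ((sample_size k \<epsilon>)\<^sup>2) \<le> (56 * (x\<^sup>2 * ln (2 + x)))\<^sup>2"
    unfolding of_nat_power x_def by (intro power_mono sample_size_le assms) auto
  also have "\<dots> = 3136 * (x ^ 4 * 1) * ln (2 + x) ^ 2"
    by (simp add: power_mult_distrib)
  \<comment> \<open>The target exponent exceeds the one obtained by two, and \<open>2 * x \<ge> 1\<close>.\<close>
  also have "\<dots> \<le> 3136 * (x ^ 4 * (2 * x) ^ 2) * ln (2 + x) ^ 2"
    using x by (intro mult_left_mono mult_right_mono one_le_power) auto
  also have "\<dots> = 12544 * x ^ 6 * ln (2 + x) ^ 2"
    by (simp add: power_mult_distrib)
  finally show ?thesis
    by (simp add: x_def power_divide)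
qed

theorem corollary5p3:
  shows "\<exists>(C::real) (c::nat). \<forall>(r::nat) (s::nat). r + s \<ge> 1 \<longrightarrow>
    (\<exists>T. size_oblivious_tester (colourable_graphs r s) T \<and>
         one_sided (colourable_graphs r s) T \<and>
         (\<forall>\<epsilon>>0. ereal_of_enat (query_complexity (T \<epsilon>)) \<le>
            ereal (C * (real (r + s) ^ 6 / \<epsilon> ^ 6) * (ln (2 + real (r + s) / \<epsilon>)) ^ c)))"
proof (rule exI[of _ 12544], rule exI[of _ 2], intro allI impI)
  fix r s :: nat
  assume k: "r + s \<ge> 1"
  \<comment> \<open>For \<open>\<epsilon> > 2\<close> no graph is far. Accepting without any query keeps the number of queries below a
    bound that tends to \<open>0\<close> as \<open>\<epsilon>\<close> grows.\<close>
  define T where "T \<epsilon> = (if \<epsilon> > 2 then Verdict True else colour_tester r s (sample_size (r + s) \<epsilon>))"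
    for \<epsilon> :: real
  let ?\<P> = "colourable_graphs r s"
  have complete: "accept_prob G (T \<epsilon>) = 1" if "G \<in> ?\<P>" "\<epsilon> > 0" for G \<epsilon>
    using accept_prob_colour_tester[OF that(1) sample_size_pos[OF that(2) k]]
    by (simp add: T_def accept_prob_def)
  have sound: "reject_prob G (T \<epsilon>) \<ge> 2 / 3" if "simple_graph G" "far_from \<epsilon> ?\<P> G" "\<epsilon> > 0" for G \<epsilon>
    using reject_prob_colour_tester[OF that k order.refl] le_2_if_far[OF that k] by (simp add: T_def)
  have trivial: "query_complexity (Verdict True) = 0" "sample_complexity (Verdict True) = 0"
    by (auto simp: query_complexity_def sample_complexity_def zero_enat_def[symmetric]
        intro!: antisym SUP_least)
  have finite: "query_complexity (T \<epsilon>) < \<infinity>" "sample_complexity (T \<epsilon>) < \<infinity>" if "\<epsilon> > 0" for \<epsilon>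
    using complexity_colour_tester[OF sample_size_pos[OF that k], of r s]
    by (auto simp: T_def trivial zero_enat_def intro: le_less_trans)
  have queries: "ereal_of_enat (query_complexity (T \<epsilon>)) \<le>
      ereal (12544 * (real (r + s) ^ 6 / \<epsilon> ^ 6) * (ln (2 + real (r + s) / \<epsilon>)) ^ 2)" if "\<epsilon> > 0" for \<epsilon>
  proof (cases "\<epsilon> > 2")
    case True
    then show ?thesis
      by (simp add: T_def trivial)
  next
    case False
    have "ereal_of_enat (query_complexity (T \<epsilon>)) \<le> ereal_of_enat (enat ((sample_size (r + s) \<epsilon>)\<^sup>2))"
      using False complexity_colour_tester(1)[OF sample_size_pos[OF that k]]
      by (simp only: ereal_of_enat_le_iff T_def if_False)
    also have "\<dots> = ereal (real ((sample_size (r + s) \<epsilon>)\<^sup>2))"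
      by simp
    also have "\<dots> \<le> ereal (12544 * (real (r + s) ^ 6 / \<epsilon> ^ 6) * (ln (2 + real (r + s) / \<epsilon>)) ^ 2)"
      using sample_size_squared_le[of \<epsilon> "r + s"] that False k by (simp only: ereal_less_eq)
    finally show ?thesis .
  qed
  show "\<exists>T. size_oblivious_tester ?\<P> T \<and> one_sided ?\<P> T \<and>
      (\<forall>\<epsilon>>0. ereal_of_enat (query_complexity (T \<epsilon>)) \<le>
        ereal (12544 * (real (r + s) ^ 6 / \<epsilon> ^ 6) * (ln (2 + real (r + s) / \<epsilon>)) ^ 2))"
    unfolding size_oblivious_tester_def one_sided_def
    using complete sound finite queries by (intro exI[of _ T]) auto
qed

end
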